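(* Let $d\in\mathbb{N}$ and let $I\subset\mathbb{N}_0^d$ be finite with $|I|\ge1$ and $|\mathscr{M}(I)|>1$. Let $r\ge0$ and put $$N_I=\max_{\boldsymbol k\in I}\|\boldsymbol k\|_\infty,\qquad M=\operatorname{nextprime}\bigl(\max(2(|\mathscr{M}(I)|-1),\,2N_I)\bigr),\qquad L=\lceil 2(r+1)\ln|I|\rceil .$$ Draw $\boldsymbol z_1,\dots,\boldsymbol z_L\in[0,M-1]^d\cap\mathbb{Z}^d$ i.i.d. uniformly at random and let $$\mathcal X=\bigcup_{\ell=1}^L\{\cos(2\pi\boldsymbol t)\colon\boldsymbol t\in\Lambda(\boldsymbol z_\ell,M)\}\subset[-1,1]^d .$$ Then $$|\mathcal X|\le 2\,\lceil 2(r+1)\ln|I|\rceil\,\max(|\mathscr{M}(I)|-1,\,N_I),$$ and the matrix $\boldsymbol C(\mathcal X,I)=(T_{\boldsymbol k}(\boldsymbol x))_{\boldsymbol x\in\mathcal X,\boldsymbol k\in I}$ has full column rank with probability at least $1-|I|^{-r}$.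
   Context: $\operatorname{nextprime}(x)=\min\{p\colon p>x,\ p\text{ prime}\}$. Univariate Chebyshev polynomials: $T_0(x)=1$ and $T_k(x)=\sqrt2\cos(k\arccos x)$ for $k\in\mathbb{N}$, $x\in[-1,1]$. Multivariate: $T_{\boldsymbol k}(\boldsymbol x)=\prod_{j=1}^dT_{k_j}(x_j)$ for $\boldsymbol k\in\mathbb{N}_0^d$, $\boldsymbol x\in[-1,1]^d$. Mirrored set: $\mathscr{M}(I)=\{(l_1k_1,\dots,l_dk_d)^\top\colon\boldsymbol k\in I,\ \boldsymbol l\in\{-1,1\}^d\}\subset\mathbb{Z}^d$. Rank-1 lattice: $\Lambda(\boldsymbol z,M)=\{\frac jM\boldsymbol z\bmod\boldsymbol 1\colon j=0,\dots,M-1\}\subset\mathbb{T}^d$, where $\mathbb{T}=\mathbb{R}/\mathbb{Z}$. The cosine is applied componentwise. *)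

theory Defs
  imports "HOL-Probability.Probability" "Jordan_Normal_Form.DL_Rank"
begin

no_notation vec_index (infixl "$" 100)

definition nextprime :: "nat \<Rightarrow> nat" where
  "nextprime x = (LEAST p. prime p \<and> x < p)"

definition cheb :: "nat \<Rightarrow> real \<Rightarrow> real" where
  "cheb k x = (if k = 0 then 1 else sqrt 2 * cos (real k * arccos x))"

definition mcheb :: "nat ^ 'd \<Rightarrow> real ^ 'd \<Rightarrow> real" where
  "mcheb k x = (\<Prod>j\<in>UNIV. cheb (k $ j) (x $ j))"

definition mirrored :: "(nat ^ 'd) set \<Rightarrow> (int ^ 'd) set" where
  "mirrored I = {(\<chi> j. l $ j * int (k $ j)) | k l :: int ^ 'd. k \<in> I \<and> (\<forall>j. l $ j \<in> {-1, 1})}"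

definition max_norm :: "nat ^ 'd \<Rightarrow> nat" where
  "max_norm k = Max (range (\<lambda>j. k $ j))"

text \<open>The torus is represented by its fundamental domain, the half-open unit cube.\<close>

definition rank1_lattice :: "int ^ 'd \<Rightarrow> nat \<Rightarrow> (real ^ 'd) set" where
  "rank1_lattice z M = {(\<chi> i. frac (real j / real M * of_int (z $ i))) | j. j < M}"

definition cos2pi :: "real ^ 'd \<Rightarrow> real ^ 'd" where
  "cos2pi t = (\<chi> i. cos (2 * pi * t $ i))"

definition cheb_nodes :: "(nat \<Rightarrow> int ^ 'd) \<Rightarrow> nat \<Rightarrow> nat \<Rightarrow> (real ^ 'd) set" where
  "cheb_nodes z L M = (\<Union>l\<in>{1..L}. cos2pi ` rank1_lattice (z l) M)"

definition cheb_matrix :: "(real ^ 'd) list \<Rightarrow> (nat ^ 'd) list \<Rightarrow> real mat" where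
  "cheb_matrix xs ks = mat (length xs) (length ks) (\<lambda>(i, j). mcheb (ks ! j) (xs ! i))"

definition full_column_rank :: "real mat \<Rightarrow> bool" where
  "full_column_rank A \<longleftrightarrow> vec_space.rank (dim_row A) A = dim_col A"

text \<open>The matrix is indexed by finite sets; its rank does not depend on the enumerations of
  rows and columns, so all of them are admitted. Finiteness is required because otherwise
  there would be no enumeration and the condition would hold vacuously.\<close>

definition cheb_full_column_rank :: "(real ^ 'd) set \<Rightarrow> (nat ^ 'd) set \<Rightarrow> bool" where
  "cheb_full_column_rank X I \<longleftrightarrow> finite X \<and> finite I \<and>
     (\<forall>xs ks. distinct xs \<and> set xs = X \<and> distinct ks \<and> set ks = I \<longrightarrow>
        full_column_rank (cheb_matrix xs ks))"

end

theory Submission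
  imports Defs "HOL-Library.Discrete_Functions"
begin

text \<open>
  Substituting \<open>x = cos (2 \<pi> t)\<close> turns \<open>T\<^sub>k\<close> into a positive multiple of the sum of the
  exponentials whose frequencies are the reflections of \<open>k\<close>. If no other frequency \<open>h\<close> of the
  mirrored set aliases with \<open>k\<close> on the lattice generated by \<open>z\<close>, i.e. \<open>h \<cdot> z \<noteq> k \<cdot> z\<close> modulo \<open>M\<close>,
  then the coefficient of \<open>T\<^sub>k\<close> can be recovered from the values on that lattice alone. For prime
  \<open>M > 2 N\<close> a fixed \<open>h\<close> aliases with \<open>k\<close> for at most a fraction \<open>1 / M\<close> of all \<open>z\<close>, so \<open>k\<close> fails
  on one lattice with probability at most \<open>1 / 2\<close> and on all of them with probability at most
  \<open>2\<^sup>-\<^sup>L\<close>; a union bound over \<open>k\<close> finishes the argument. Since \<open>t\<close> and \<open>- t\<close> give the same node, a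
  lattice yields only about \<open>M / 2\<close> nodes, and Bertrand's postulate bounds \<open>M\<close>.
\<close>

subsection \<open>Bertrand's postulate\<close>

text \<open>
  Erdos' argument: without a prime in \<open>(n, 2 n]\<close>, every prime factor of the central binomial
  coefficient is at most \<open>2 n / 3\<close>. The factors up to \<open>sqrt (2 n)\<close> contribute at most \<open>2 n\<close> each,
  the others occur only once, and together this is smaller than \<open>4\<^sup>n / (2 n)\<close>.
\<close>

lemma prod_primes_dvd:
  fixes S :: "nat set"
  assumes "finite S" "\<And>p. p \<in> S \<Longrightarrow> prime p \<and> p dvd x"
  shows "\<Prod>S dvd x"
  using assms
proof (induction S rule: finite_induct)
  case (insert p S)
  have "coprime p q" if "q \<in> S" for q
    using insert.prems[of p] insert.prems[of q] insert.hyps that by (metis insertCI primes_coprime)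
  then have "coprime p (\<Prod>S)"
    by (intro prod_coprime_right)
  then show ?case
    using insert by (simp add: divides_mult)
qed auto

text \<open>The two middle entries of row \<open>2 * m + 1\<close> are equal, and together they are
  at most the row sum \<open>2 ^ (2 * m + 1)\<close>.\<close>

lemma binomial_Suc_double_le: "(2 * m + 1) choose m \<le> 4 ^ m"
proof -
  have "2 * ((2 * m + 1) choose m) = (\<Sum>k\<in>{m, Suc m}. (2 * m + 1) choose k)"
    using central_binomial_odd[of "2 * m + 1"] by simp
  also have "\<dots> \<le> (\<Sum>k\<le>2 * m + 1. (2 * m + 1) choose k)"
    by (rule sum_mono2) auto
  also have "\<dots> = 2 ^ (2 * m + 1)"
    by (rule choose_row_sum)
  finally show ?thesis
    by (simp add: power_mult)
qed

text \<open>Strong induction. An even \<open>n > 2\<close> is not prime and reduces to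
  \<open>n - 1\<close>. For \<open>n = 2 * m + 1\<close>, the primes above \<open>m + 1\<close> all
  divide \<open>n choose m\<close>, which is at most \<open>4 ^ m\<close>, and the others are
  covered by the hypothesis for \<open>m + 1\<close>.\<close>

lemma primorial_le: "\<Prod>{p. prime p \<and> p \<le> n} \<le> (4::nat) ^ n"
proof (induction n rule: less_induct)
  case (less n)
  consider "n < 2" | "n = 2" | "n > 2" "even n" | "n > 2" "odd n"
    by linarith
  then show ?case
  proof cases
    case 1
    then have "p > n" if "prime p" for p
      using prime_ge_2_nat[OF that] by simp
    then have empty: "{p. prime p \<and> p \<le> n} = {}"
      by (simp add: not_le)
    show ?thesis unfolding empty by simp
  next
    case 2
    have two: "{p. prime p \<and> p \<le> n} = {2}"
      unfolding 2 by (auto intro: antisym dest: prime_ge_2_nat)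
    show ?thesis unfolding two by (simp add: 2)
  next
    case 3
    then have "\<not> prime n"
      using prime_odd_nat by blast
    then have eq: "{p. prime p \<and> p \<le> n} = {p. prime p \<and> p \<le> n - 1}"
      by (auto simp: le_less)
    have "\<Prod>{p. prime p \<and> p \<le> n} \<le> (4::nat) ^ (n - 1)"
      unfolding eq using less 3 by simp
    also have "\<dots> \<le> 4 ^ n"
      by (rule power_increasing) auto
    finally show ?thesis .
  next
    case 4
    then obtain m where n: "n = 2 * m + 1" and m: "m \<ge> 1"
      by (elim oddE) auto
    let ?A = "{p. prime p \<and> p \<le> m + 1}" and ?B = "{p. prime p \<and> m + 1 < p \<and> p \<le> n}"
    have "p dvd n choose m" if "p \<in> ?B" for p
    proof -
      have "p dvd fact n"
        using that by (simp add: prime_dvd_fact_iff)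
      also have "fact n = fact m * fact (n - m) * (n choose m)"
        using binomial_fact_lemma[of m n] n by simp
      finally have "p dvd fact m * fact (n - m) * (n choose m)" .
      moreover have "\<not> p dvd fact m" "\<not> p dvd fact (n - m)"
        using that n by (auto simp: prime_dvd_fact_iff simp del: fact_Suc)
      ultimately show ?thesis
        using that prime_dvd_multD by blast
    qed
    then have "\<Prod>?B dvd n choose m"
      by (intro prod_primes_dvd) auto
    then have "\<Prod>?B \<le> n choose m"
      using n by (intro dvd_imp_le) auto
    also have "\<dots> \<le> 4 ^ m"
      unfolding n by (rule binomial_Suc_double_le)
    finally have B: "\<Prod>?B \<le> 4 ^ m" .
    have "{p. prime p \<and> p \<le> n} = ?A \<union> ?B"
      using n by auto
    then have "\<Prod>{p. prime p \<and> p \<le> n} = \<Prod>?A * \<Prod>?B"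
      by (simp add: prod.union_disjoint disjoint_iff)
    also have "\<dots> \<le> 4 ^ (m + 1) * 4 ^ m"
      by (intro mult_mono B less) (use n m in auto)
    also have "\<dots> = 4 ^ n"
      by (simp add: n power_add mult_2)
    finally show ?thesis .
  qed
qed

section \<open>Legendre's formula and the prime powers in central binomial coefficients\<close>

lemma multiplicity_eq_sum:
  fixes p n :: nat
  assumes "prime p" "n > 0" "n < p ^ Suc K"
  shows "multiplicity p n = (\<Sum>i=1..K. if p ^ i dvd n then 1 else 0)"
proof -
  have "multiplicity p n < Suc K"
    using assms by (metis dvd_imp_le le_less_trans multiplicity_dvd power_less_imp_less_exp prime_gt_1_nat)
  then have "{i \<in> {1..K}. p ^ i dvd n} = {1..multiplicity p n}"
    using assms by (auto simp: power_dvd_iff_le_multiplicity dest: prime_gt_1_nat)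
  then have "multiplicity p n = card {i \<in> {1..K}. p ^ i dvd n}"
    by simp
  also have "\<dots> = (\<Sum>i=1..K. if p ^ i dvd n then 1 else 0)"
    by (simp add: sum.If_cases Int_def)
  finally show ?thesis .
qed

text \<open>Legendre's formula, cut off at \<open>K\<close> because all later quotients vanish.
  Passing from \<open>n\<close> to \<open>Suc n\<close> raises \<open>n div p ^ i\<close> exactly
  when \<open>p ^ i\<close> divides \<open>Suc n\<close>.\<close>

lemma multiplicity_fact:
  fixes p n :: nat
  assumes "prime p" "n < p ^ Suc K"
  shows "multiplicity p (fact n) = (\<Sum>i=1..K. n div p ^ i)"
  using assms(2)
proof (induction n)
  case (Suc n)
  have "multiplicity p (fact (Suc n) :: nat) = multiplicity p (Suc n) + multiplicity p (fact n :: nat)"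
    unfolding fact_Suc using assms(1)
    by (subst prime_elem_multiplicity_mult_distrib) (auto simp del: mult_Suc)
  also have "\<dots> = (\<Sum>i=1..K. (if p ^ i dvd Suc n then 1 else 0) + n div p ^ i)"
    using Suc assms(1) by (simp add: multiplicity_eq_sum sum.distrib)
  also have "\<dots> = (\<Sum>i=1..K. Suc n div p ^ i)"
    by (intro sum.cong) (auto simp: div_Suc mod_eq_0_iff_dvd)
  finally show ?case .
qed auto

lemma multiplicity_central_binomial:
  fixes p n :: nat
  assumes "prime p" "2 * n < p ^ Suc K"
  shows "multiplicity p (2 * n choose n) = (\<Sum>i=1..K. 2 * n div p ^ i - 2 * (n div p ^ i))"
proof -
  have "multiplicity p (fact (2 * n) :: nat) =
      2 * multiplicity p (fact n :: nat) + multiplicity p (2 * n choose n)"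
    using assms(1) binomial_fact_lemma[of n "2 * n", symmetric]
    by (simp add: prime_elem_multiplicity_mult_distrib)
  then have "multiplicity p (2 * n choose n) =
      multiplicity p (fact (2 * n) :: nat) - 2 * multiplicity p (fact n :: nat)"
    by simp
  also have "\<dots> = (\<Sum>i=1..K. 2 * n div p ^ i) - (\<Sum>i=1..K. 2 * (n div p ^ i))"
    using multiplicity_fact[OF assms] multiplicity_fact[of p n K] assms
    by (simp add: sum_distrib_left)
  also have "\<dots> = (\<Sum>i=1..K. 2 * n div p ^ i - 2 * (n div p ^ i))"
  \<comment> \<open>Subtraction of natural numbers is truncated, so it commutes with the sum only
    after a termwise comparison.\<close>
  proof (rule sum_subtractf_nat[symmetric])
    show "2 * (n div q) \<le> 2 * n div q" for q
      using div_add1_eq[of n n q] by (simp add: mult_2)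
  qed
  finally show ?thesis .
qed

text \<open>Each term of the formula is at most 1, and with \<open>K\<close> the largest exponent
  such that \<open>p ^ K \<le> 2 * n\<close> there are only \<open>K\<close> terms.\<close>

lemma power_multiplicity_central_binomial_le:
  fixes p n :: nat
  assumes "prime p" "n > 0"
  shows "p ^ multiplicity p (2 * n choose n) \<le> 2 * n"
proof -
  have p: "p \<ge> 2" using assms(1) by (rule prime_ge_2_nat)
  obtain K where K: "p ^ K \<le> 2 * n" "2 * n < p ^ Suc K"
    using ex_power_ivl1[OF p, of "2 * n"] assms(2) by auto
  have "2 * n div q - 2 * (n div q) \<le> 1" for q
  proof -
    have "(n mod q + n mod q) div q < 2"
      by (cases "q = 0") (auto intro!: less_mult_imp_div_less simp: mult_2 add_strict_mono)
    then show ?thesis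
      using div_add1_eq[of n n q] by (simp add: mult_2)
  qed
  then have "multiplicity p (2 * n choose n) \<le> (\<Sum>i=1..K. 1)"
    unfolding multiplicity_central_binomial[OF assms(1) K(2)] by (intro sum_mono)
  then have "p ^ multiplicity p (2 * n choose n) \<le> p ^ K"
    using p by (intro power_increasing) auto
  with K show ?thesis by linarith
qed

text \<open>Since \<open>p \<ge> 3\<close>, the square of \<open>p\<close> exceeds
  \<open>2 * n\<close>, so only the term for \<open>i = 1\<close> remains, and it is
  \<open>2 - 2 * 1\<close>.\<close>

lemma multiplicity_central_binomial_eq_0:
  fixes p n :: nat
  assumes "prime p" "p > 2" "p \<le> n" "2 * n < 3 * p"
  shows "multiplicity p (2 * n choose n) = 0"
proof -
  have "3 * p \<le> p * p"
    using assms(2) by simp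
  with assms(4) have "2 * n < p * p"
    by (rule less_le_trans)
  then have "2 * n < p ^ Suc 1"
    by simp
  then have "multiplicity p (2 * n choose n) = 2 * n div p - 2 * (n div p)"
    using multiplicity_central_binomial[OF assms(1), of n 1] by simp
  moreover have "2 * n div p = 2" "n div p = 1"
    using assms by (auto intro!: div_nat_eqI)
  ultimately show ?thesis by simp
qed

text \<open>The tangent of the logarithm at 32 gives
  \<open>6 * ln x \<le> 30 * ln 2 + (x - 32) * (6 / 32)\<close>. Its slope is below
  \<open>ln 2\<close>, and at \<open>x = 32\<close> there remains a gap of \<open>2 * ln 2\<close>.
  The value 32 is \<open>sqrt (2 * 512)\<close>, matching the threshold for large \<open>n\<close>
  below.\<close>

lemma ln_less_div_6:
  fixes x :: real
  assumes "x \<ge> 32"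
  shows "6 * ln x < x * ln 2"
proof -
  have "ln (x / 32) \<le> x / 32 - 1"
    using assms by (intro ln_le_minus_one) auto
  moreover have "ln (32::real) = 5 * ln 2"
    using ln_realpow[of "2::real" 5] by simp
  ultimately have "6 * ln x \<le> 30 * ln 2 + (x - 32) * (6 / 32)"
    using assms by (simp add: ln_div field_simps)
  also have "ln (2::real) > 1 / 2"
    using ln2_ge_two_thirds by simp
  then have "(x - 32) * (6 / 32) \<le> (x - 32) * ln 2"
    using assms by (intro mult_left_mono) auto
  then have "30 * ln 2 + (x - 32) * (6 / 32) < x * ln 2"
    using \<open>ln 2 > 1 / 2\<close> by (simp add: algebra_simps)
  finally show ?thesis .
qed

text \<open>The candidate divisors form a list so that simplification can run through them for
  numerals.\<close>

lemma prime_trial_division: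
  fixes n s :: nat
  assumes "n > 1" "n < s * s" "\<And>d. d \<in> set [2..<s] \<Longrightarrow> \<not> d dvd n"
  shows "prime n"
proof (rule ccontr)
  assume np: "\<not> prime n"
  obtain p where p: "prime p" "p dvd n"
    using prime_factor_nat[of n] assms(1) by auto
  then obtain m where n: "n = p * m" by auto
  have large: "s \<le> d" if "d dvd n" "d > 1" for d
    using assms(3)[of d] that by (cases "d < s") auto
  have "m > 1"
    using np p(1) n assms(1) by (cases "m = 0 \<or> m = 1") auto
  then have "s * s \<le> p * m"
    using prime_gt_1_nat[OF p(1)] n by (intro mult_mono large) auto
  with assms(2) n show False by simp
qed

lemma Bertrand_postulate_large:
  fixes n :: nat
  assumes n: "n \<ge> 512"
  shows "\<exists>p. prime p \<and> n < p \<and> p \<le> 2 * n"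
proof (rule ccontr)
  assume no: "\<nexists>p. prime p \<and> n < p \<and> p \<le> 2 * n"
  define C where "C = 2 * n choose n"
  define s where "s = floor_sqrt (2 * n)"
  have C0: "C \<noteq> 0" by (simp add: C_def)
  have s1: "s \<ge> 1"
    using n by (simp add: s_def le_floor_sqrt_iff)
  have bound: "p ^ multiplicity p C \<le> 2 * n" if "prime p" for p
    unfolding C_def using that n by (intro power_multiplicity_central_binomial_le) auto
  have pf: "prime p \<and> 2 \<le> p \<and> 3 * p \<le> 2 * n" if "p \<in> prime_factors C" for p
  proof -
    have p: "prime p" "p dvd C" using that by auto
    then have m: "multiplicity p C > 0"
      using C0 by (simp add: prime_multiplicity_gt_zero_iff)
    then have "p ^ 1 \<le> p ^ multiplicity p C"
      using p prime_gt_0_nat by (intro power_increasing) (auto simp: Suc_le_eq)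
    then have "p \<le> 2 * n" using bound[OF p(1)] by simp
    then have "p \<le> n" using no p(1) by (meson not_le)
    moreover have "3 * p \<le> 2 * n"
    \<comment> \<open>The vanishing result excludes 2, for which the bound follows from the size of
      \<open>n\<close>.\<close>
    proof (cases "p = 2")
      case False
      then show ?thesis
        using m multiplicity_central_binomial_eq_0[OF p(1) _ \<open>p \<le> n\<close>] prime_ge_2_nat[OF p(1)]
        by (cases "2 * n < 3 * p") (auto simp: C_def)
    qed (use n in auto)
    ultimately show ?thesis using p(1) prime_ge_2_nat[OF p(1)] by simp
  qed
  let ?S = "{p \<in> prime_factors C. p \<le> s}" and ?B = "{p \<in> prime_factors C. s < p}"
  have "(\<Prod>p\<in>?S. p ^ multiplicity p C) \<le> (\<Prod>p\<in>?S. 2 * n)"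
    by (intro prod_mono) (auto intro: bound)
  also have "\<dots> = (2 * n) ^ card ?S"
    by simp
  \<comment> \<open>Counting from 2 gives the exponent \<open>s - 1\<close>. The factor
    \<open>2 * n\<close> from the lower bound \<open>4 ^ n \<le> 2 * n * C\<close> then raises it to
    \<open>s\<close>.\<close>
  also have "card ?S \<le> card {2..s}"
    by (intro card_mono subsetI) (use pf in auto)
  then have "(2 * n) ^ card ?S \<le> (2 * n) ^ (s - 1)"
    using n by (intro power_increasing) auto
  finally have S: "(\<Prod>p\<in>?S. p ^ multiplicity p C) \<le> (2 * n) ^ (s - 1)" .
  have "p ^ multiplicity p C \<le> p" if "p \<in> ?B" for p
  proof -
    have "2 * n < (Suc s)\<^sup>2"
      unfolding s_def by (rule Suc_floor_sqrt_power2_gt)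
    also have "\<dots> \<le> p\<^sup>2"
      using that by (intro power_mono) auto
    finally have "2 * n < p ^ 2" .
    moreover have "p ^ multiplicity p C \<le> 2 * n"
      using bound[of p] pf[of p] that by simp
    ultimately have "p ^ multiplicity p C < p ^ 2"
      by (rule le_less_trans[rotated])
    then have "multiplicity p C < 2"
      using pf[of p] that by simp
    then have "p ^ multiplicity p C \<le> p ^ 1"
      using that pf[of p] by (intro power_increasing) auto
    then show ?thesis by simp
  qed
  then have "(\<Prod>p\<in>?B. p ^ multiplicity p C) \<le> \<Prod>?B"
    by (intro prod_mono) auto
  also have "\<dots> \<le> \<Prod>{p. prime p \<and> p \<le> 2 * n div 3}"
  proof (intro dvd_imp_le prod_dvd_prod_subset)
    show "?B \<subseteq> {p. prime p \<and> p \<le> 2 * n div 3}"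
      using pf by fastforce
    show "\<Prod>{p. prime p \<and> p \<le> 2 * n div 3} > 0"
      by (intro prod_pos) (simp add: prime_gt_0_nat)
  qed simp
  also have "\<dots> \<le> 4 ^ (2 * n div 3)"
    by (rule primorial_le)
  finally have B: "(\<Prod>p\<in>?B. p ^ multiplicity p C) \<le> 4 ^ (2 * n div 3)" .
  have "C = (\<Prod>p\<in>prime_factors C. p ^ multiplicity p C)"
    using C0 by (simp add: prod_prime_factors)
  also have "prime_factors C = ?S \<union> ?B"
    by auto
  also have "(\<Prod>p\<in>?S \<union> ?B. p ^ multiplicity p C) =
      (\<Prod>p\<in>?S. p ^ multiplicity p C) * (\<Prod>p\<in>?B. p ^ multiplicity p C)"
    by (rule prod.union_disjoint) auto
  also have "\<dots> \<le> (2 * n) ^ (s - 1) * 4 ^ (2 * n div 3)"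
    by (intro mult_mono S B) auto
  finally have C_le: "C \<le> (2 * n) ^ (s - 1) * 4 ^ (2 * n div 3)" .
  have "4 ^ n \<le> real (2 * n) * real C"
    using central_binomial_lower_bound[of n] n by (simp add: C_def field_simps)
  also have "\<dots> \<le> real (2 * n) * real ((2 * n) ^ (s - 1) * 4 ^ (2 * n div 3))"
    using C_le by (intro mult_left_mono) (auto simp del: of_nat_mult of_nat_power)
  also have "\<dots> = real (2 * n) ^ s * 4 ^ (2 * n div 3)"
    using s1 by (cases s) auto
  finally have "ln (4 ^ n) \<le> ln (real (2 * n) ^ s * 4 ^ (2 * n div 3))"
    using n by (subst ln_le_cancel_iff) auto
  then have "n * ln 4 \<le> s * ln (2 * n) + real (2 * n div 3) * ln 4"
    using n by (simp add: ln_mult ln_realpow algebra_simps)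
  moreover have "real (2 * n div 3) * ln 4 \<le> (2 * n / 3) * ln 4"
    by (intro mult_right_mono) (linarith, simp)
  moreover have "n * ln 4 = (2 * n / 3) * ln 4 + (n / 3) * ln (4::real)"
    by (simp add: field_simps)
  ultimately have main: "(n / 3) * ln 4 \<le> s * ln (2 * n)"
    by linarith
  \<comment> \<open>In terms of \<open>x\<close>, the estimate reduces to
    \<open>x * ln 2 \<le> 6 * ln x\<close>, and \<open>n \<ge> 512\<close> becomes
    \<open>x \<ge> 32\<close>.\<close>
  define x where "x = sqrt (2 * n)"
  have x2: "x\<^sup>2 = 2 * n" by (simp add: x_def)
  have x: "x \<ge> 32"
    using n unfolding x_def by (intro real_le_rsqrt) simp
  have "real (s\<^sup>2) \<le> real (2 * n)"
    unfolding s_def by (subst of_nat_le_iff) (rule floor_sqrt_power2_le)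
  then have "real s \<le> x"
    unfolding x_def by (intro real_le_rsqrt) simp
  then have "s * ln (2 * n) \<le> x * ln (x\<^sup>2)"
    unfolding x2 using n by (intro mult_right_mono) auto
  also have "\<dots> = 2 * x * ln x"
    using x by (simp add: ln_realpow)
  finally have "(x\<^sup>2 / 6) * ln 4 \<le> 2 * x * ln x"
    using main x2 by simp
  moreover have "ln (4::real) = 2 * ln 2"
    using ln_realpow[of "2::real" 2] by simp
  ultimately have "x * (x * ln 2) \<le> x * (6 * ln x)"
    by (simp add: power2_eq_square field_simps)
  then have "x * ln 2 \<le> 6 * ln x"
    using x by simp
  with ln_less_div_6[OF x] show False by simp
qed

theorem Bertrand_postulate:
  fixes n :: nat
  assumes "n \<ge> 1"
  shows "\<exists>p. prime p \<and> n < p \<and> p \<le> 2 * n"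
proof (cases "n \<ge> 512")
  case False
  show ?thesis
  proof (rule ccontr)
    assume no: "\<not> ?thesis"
    have step: "2 * n < p" if "prime p" "n < p" for p
      using no that by (meson not_le)
    \<comment> \<open>In the chain 2, 3, 5, 7, 13, 23, 43, 83, 163, 317, 631 each prime is less than
      twice its predecessor. So a bound \<open>2 * n < p\<close> puts \<open>n\<close> below the
      next smaller prime, and \<open>step\<close> applies again.\<close>
    have "2 * n < 631" using False by (intro step prime_trial_division[of _ 26]) auto
    then have "2 * n < 317" by (intro step prime_trial_division[of _ 18]) auto
    then have "2 * n < 163" by (intro step prime_trial_division[of _ 13]) auto
    then have "2 * n < 83" by (intro step prime_trial_division[of _ 10]) auto
    then have "2 * n < 43" by (intro step prime_trial_division[of _ 7]) auto
    then have "2 * n < 23" by (intro step) simp_all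
    then have "2 * n < 13" by (intro step) simp_all
    then have "2 * n < 7" by (intro step) simp_all
    then have "2 * n < 5" by (intro step) simp_all
    then have "2 * n < 3" by (intro step) simp_all
    then have "2 * n < 2" by (intro step) simp_all
    with assms show False by simp
  qed
qed (rule Bertrand_postulate_large)

subsection \<open>Nodes\<close>

lemma nextprime_prime: "prime (nextprime x)"
  and nextprime_greater: "x < nextprime x"
  using LeastI_ex[OF bigger_prime[of x]] by (auto simp: nextprime_def)

lemma nextprime_le: "prime p \<Longrightarrow> x < p \<Longrightarrow> nextprime x \<le> p"
  unfolding nextprime_def by (rule Least_le) simp

text \<open>The reduction modulo 1 is dropped, since the cosine does not see it; this leaves angles
  that are linear in \<open>s\<close>.\<close>

definition node :: "int ^ 'd \<Rightarrow> nat \<Rightarrow> nat \<Rightarrow> real ^ 'd" where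
  "node v M s = (\<chi> i. cos (2 * pi * (real s * of_int (v $ i) / real M)))"

lemma cos_2pi_frac: "cos (2 * pi * frac x) = cos (2 * pi * x)"
  by (simp add: frac_def right_diff_distrib cos_diff)

lemma cos2pi_image_rank1_lattice: "cos2pi ` rank1_lattice v M = node v M ` {..<M}"
proof -
  have "rank1_lattice v M = (\<lambda>s. \<chi> i. frac (real s / real M * of_int (v $ i))) ` {..<M}"
    by (auto simp: rank1_lattice_def)
  then show ?thesis
    by (simp add: image_image cos2pi_def node_def cos_2pi_frac)
qed

lemma node_reflect:
  assumes "M > 0" "s \<le> M"
  shows "node v M (M - s) = node v M s"
proof -
  have "cos (2 * pi * (real (M - s) * of_int a / real M)) = cos (2 * pi * (real s * of_int a / real M))" for a
  proof -
    have "2 * pi * (real (M - s) * of_int a / real M) = 2 * pi * of_int a - 2 * pi * (real s * of_int a / real M)"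
      using assms by (simp add: of_nat_diff field_simps)
    then show ?thesis
      by (simp only: cos_diff cos_int_2pin sin_int_2pin mult_1_left mult_zero_left add_0_right)
  qed
  then show ?thesis by (simp add: node_def)
qed

text \<open>The reflection \<open>s \<mapsto> M - s\<close> moves every index above
  \<open>M div 2\<close> into \<open>{..M div 2}\<close> without changing the node.\<close>

lemma card_cos2pi_rank1_lattice_le:
  "finite (cos2pi ` rank1_lattice v M)" "card (cos2pi ` rank1_lattice v M) \<le> M div 2 + 1"
proof -
  have "node v M s \<in> node v M ` {..M div 2}" if "s < M" for s
  proof (cases "s \<le> M div 2")
    case False
    then have "M - s \<le> M div 2" by linarith
    then show ?thesis
      using node_reflect[of M s v] that by (metis atMost_iff gr_zeroI imageI less_imp_le not_less0)
  qed auto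
  then have sub: "cos2pi ` rank1_lattice v M \<subseteq> node v M ` {..M div 2}"
    by (auto simp: cos2pi_image_rank1_lattice)
  then show "finite (cos2pi ` rank1_lattice v M)"
    by (rule finite_subset) simp
  have "card (cos2pi ` rank1_lattice v M) \<le> card (node v M ` {..M div 2})"
    by (intro card_mono sub) simp
  also have "\<dots> \<le> M div 2 + 1"
    using card_image_le[of "{..M div 2}" "node v M"] by simp
  finally show "card (cos2pi ` rank1_lattice v M) \<le> M div 2 + 1" .
qed

lemma finite_cheb_nodes: "finite (cheb_nodes z L M)"
  by (auto simp: cheb_nodes_def card_cos2pi_rank1_lattice_le)

lemma card_cheb_nodes_le: "card (cheb_nodes z L M) \<le> L * (M div 2 + 1)"
proof -
  have "card (cheb_nodes z L M) \<le> (\<Sum>l\<in>{1..L}. card (cos2pi ` rank1_lattice (z l) M))"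
    unfolding cheb_nodes_def by (rule card_UN_le) simp
  also have "\<dots> \<le> (\<Sum>l\<in>{1..L}. M div 2 + 1)"
    by (intro sum_mono card_cos2pi_rank1_lattice_le)
  finally show ?thesis by simp
qed

subsection \<open>Chebyshev polynomials on lattice nodes\<close>

text \<open>By the three-term recurrence, \<open>cos (k * t)\<close> is a polynomial in
  \<open>cos t\<close>. This replaces \<open>arccos (cos a)\<close> by \<open>a\<close> for angles
  outside the principal range.\<close>

lemma cos_nat_mult_cong:
  fixes a b :: real
  assumes "cos a = cos b"
  shows "cos (real k * a) = cos (real k * b)"
proof (induction k rule: induct_nat_012)
  case (ge2 k)
  have rec: "cos (real (Suc (Suc k)) * t) = 2 * cos t * cos (real (Suc k) * t) - cos (real k * t)" for t :: real
  proof -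
    have "real (Suc (Suc k)) * t = real (Suc k) * t + t" "real k * t = real (Suc k) * t - t"
      by (simp_all add: algebra_simps)
    then show ?thesis
      by (simp only: cos_add cos_diff) simp
  qed
  show ?case
    unfolding rec using ge2 assms by simp
qed (use assms in simp_all)

text \<open>The factor left when the cosine is written as a sum of two exponentials. For
  \<open>k = 0\<close> both exponentials are 1, hence \<open>1 / 2\<close>.\<close>

definition cheb_weight :: "nat \<Rightarrow> real" where
  "cheb_weight k = (if k = 0 then 1 / 2 else sqrt 2 / 2)"

lemma cheb_cos: "complex_of_real (cheb k (cos a)) =
    of_real (cheb_weight k) * (\<Sum>l\<in>{-1, 1::int}. cis (of_int l * (real k * a)))"
proof -
  have "cos (real k * arccos (cos a)) = cos (real k * a)"
    by (rule cos_nat_mult_cong) simp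
  moreover have "(\<Sum>l\<in>{-1, 1::int}. cis (of_int l * b)) = of_real (2 * cos b)" for b
    by (simp add: complex_eq_iff)
  ultimately show ?thesis
    by (simp add: cheb_def cheb_weight_def del: of_real_mult) (simp add: mult.left_commute)
qed

lemma prod_cis: "(\<Prod>i\<in>A. cis (f i)) = cis (\<Sum>i\<in>A. f i)"
  by (induction A rule: infinite_finite_induct) (simp_all add: cis_mult)

definition dot :: "int ^ 'd \<Rightarrow> int ^ 'd \<Rightarrow> int" where
  "dot a b = (\<Sum>i\<in>UNIV. a $ i * b $ i)"

lemma dot_diff_left: "dot (a - b) v = dot a v - dot b v"
  by (simp add: dot_def left_diff_distrib sum_subtractf)

text \<open>Signs are functions rather than vectors, to fit the index set that arises when a product
  of sums is expanded.\<close>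

definition reflect :: "('d \<Rightarrow> int) \<Rightarrow> nat ^ 'd \<Rightarrow> int ^ 'd" where
  "reflect l k = (\<chi> i. l i * int (k $ i))"

abbreviation signs :: "('d \<Rightarrow> int) set" where
  "signs \<equiv> UNIV \<rightarrow>\<^sub>E {-1, 1}"

lemma reflect_in_mirrored: "k \<in> I \<Longrightarrow> l \<in> signs \<Longrightarrow> reflect l k \<in> mirrored I"
  unfolding mirrored_def reflect_def
  by (rule CollectI, intro exI[of _ k] exI[of _ "\<chi> i. l i"]) auto

lemma reflect_eq_1D:
  assumes "l \<in> signs" "reflect l k = reflect (\<lambda>_. 1) k'"
  shows "k = k'"
proof -
  have "k $ i = k' $ i" for i
  proof -
    have "l i * int (k $ i) = int (k' $ i)"
      using assms(2) by (simp add: reflect_def Finite_Cartesian_Product.vec_eq_iff)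
    moreover have "l i = -1 \<or> l i = 1"
      using assms(1) by auto
    ultimately show ?thesis by auto
  qed
  then show ?thesis by (simp add: Finite_Cartesian_Product.vec_eq_iff)
qed

lemma mcheb_node:
  fixes k :: "nat ^ 'd"
  shows "complex_of_real (mcheb k (node v M s)) = of_real (\<Prod>i\<in>UNIV. cheb_weight (k $ i)) *
    (\<Sum>l\<in>signs. cis (2 * pi * real s * of_int (dot (reflect l k) v) / real M))"
proof -
  have "complex_of_real (mcheb k (node v M s)) =
      of_real (\<Prod>i\<in>UNIV. cheb_weight (k $ i)) * (\<Prod>i\<in>UNIV. \<Sum>l\<in>{-1, 1::int}.
        cis (of_int l * (real (k $ i) * (2 * pi * (real s * of_int (v $ i) / real M)))))"
    by (simp only: mcheb_def of_real_prod node_def vec_lambda_beta cheb_cos prod.distrib)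
  also have "(\<Prod>i\<in>UNIV. \<Sum>l\<in>{-1, 1::int}.
        cis (of_int l * (real (k $ i) * (2 * pi * (real s * of_int (v $ i) / real M))))) =
      (\<Sum>l\<in>signs. \<Prod>i\<in>UNIV.
        cis (of_int (l i) * (real (k $ i) * (2 * pi * (real s * of_int (v $ i) / real M)))))"
    by (rule prod_sum_PiE) auto
  also have "\<dots> = (\<Sum>l\<in>signs. cis (2 * pi * real s * of_int (dot (reflect l k) v) / real M))"
    unfolding prod_cis
    by (intro sum.cong refl arg_cong[of _ _ cis])
       (simp add: dot_def reflect_def sum_distrib_left sum_divide_distrib mult_ac)
  finally show ?thesis .
qed

text \<open>Orthogonality of characters modulo \<open>M\<close>: a geometric sum whose ratio is an
  \<open>M\<close>-th root of unity, equal to 1 exactly when \<open>M\<close> divides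
  \<open>a\<close>.\<close>

lemma sum_cis_lattice:
  assumes "M > 0"
  shows "(\<Sum>s<M. cis (2 * pi * real s * of_int a / real M)) = (if int M dvd a then of_nat M else 0)"
proof -
  define w where "w = cis (2 * pi * of_int a / real M)"
  have wM: "w ^ M = 1"
  proof -
    have "w ^ M = cis (2 * pi * of_int a)"
      unfolding w_def Complex.DeMoivre using assms by (intro arg_cong[of _ _ cis]) simp
    then show ?thesis by simp
  qed
  have w1: "w = 1 \<longleftrightarrow> int M dvd a"
  proof
    assume "w = 1"
    then have "cos (2 * pi * of_int a / real M) = 1"
      by (simp add: w_def complex_eq_iff)
    then obtain n :: int where "2 * pi * of_int a / real M = of_int n * 2 * pi"
      by (auto simp: cos_one_2pi_int)
    then have "real_of_int a = of_int (n * int M)"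
      using assms by (simp add: field_simps)
    then show "int M dvd a"
      by (simp only: of_int_eq_iff) simp
  next
    assume "int M dvd a"
    then obtain n where a: "a = int M * n" ..
    have "w = cis (2 * pi * of_int n)"
      unfolding w_def a using assms by (intro arg_cong[of _ _ cis]) simp
    also have "\<dots> = 1" by (rule cis_multiple_2pi) simp
    finally show "w = 1" .
  qed
  have "(\<Sum>s<M. cis (2 * pi * real s * of_int a / real M)) = (\<Sum>s<M. w ^ s)"
    by (intro sum.cong refl) (simp add: w_def Complex.DeMoivre mult_ac)
  also have "\<dots> = (if w = 1 then of_nat M else (1 - w ^ M) / (1 - w))"
    by (rule sum_gp_strict)
  finally show ?thesis
    by (simp add: wM w1)
qed

lemma mcheb_coeff_eq_0:
  fixes I :: "(nat ^ 'd) set" and c :: "nat ^ 'd \<Rightarrow> real" and v :: "int ^ 'd"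
  defines "e \<equiv> reflect (\<lambda>_. 1)"
  assumes I: "finite I" "k0 \<in> I" and M: "M > 0"
    and good: "\<And>h. h \<in> mirrored I \<Longrightarrow> h \<noteq> e k0 \<Longrightarrow> \<not> int M dvd dot (h - e k0) v"
    and zero: "\<And>s. s < M \<Longrightarrow> (\<Sum>k\<in>I. c k * mcheb k (node v M s)) = 0"
  shows "c k0 = 0"
proof -
  define W where "W k = (\<Prod>i\<in>UNIV. cheb_weight (k $ i))" for k :: "nat ^ 'd"
  define E where "E s a = cis (2 * pi * real s * of_int a / real M)" for s a
  \<comment> \<open>Signs at zero entries of \<open>k0\<close> have no effect, so the frequency
    \<open>e k0\<close> may occur several times; it occurs at least once, for the constant sign
    1.\<close>
  define n where "n = card {l \<in> signs. reflect l k0 = e k0}"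
  have E_mult: "E s (- a) * E s b = E s (b - a)" for s a b
    unfolding E_def cis_mult by (intro arg_cong[of _ _ cis]) (use M in \<open>simp add: field_simps\<close>)
  have mcheb_E: "complex_of_real (mcheb k (node v M s)) =
      of_real (W k) * (\<Sum>l\<in>signs. E s (dot (reflect l k) v))" for k s
    unfolding W_def E_def by (rule mcheb_node)
  have fin: "finite (signs :: ('d \<Rightarrow> int) set)"
    by (intro finite_PiE) auto
  have sum_E: "(\<Sum>s<M. E s (dot (reflect l k) v - dot (e k0) v)) =
      (if reflect l k = e k0 then of_nat M else 0)" if "k \<in> I" "l \<in> signs" for k l
    using good[OF reflect_in_mirrored[OF that]] sum_cis_lattice[OF M, of "dot (reflect l k) v - dot (e k0) v"]
    by (auto simp: E_def dot_diff_left)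
  \<comment> \<open>This is the discrete Fourier coefficient at \<open>e k0\<close>. Orthogonality
    together with \<open>good\<close> removes every other frequency, and only \<open>k0\<close>
    itself has \<open>e k0\<close> among its reflections.\<close>
  have "0 = (\<Sum>s<M. E s (- dot (e k0) v) * of_real (\<Sum>k\<in>I. c k * mcheb k (node v M s)))"
    using zero by simp
  also have "\<dots> = (\<Sum>s<M. \<Sum>k\<in>I. \<Sum>l\<in>signs.
      of_real (c k * W k) * E s (dot (reflect l k) v - dot (e k0) v))"
    by (simp only: of_real_sum of_real_mult mcheb_E sum_distrib_left E_mult[symmetric] mult_ac)
  also have "\<dots> = (\<Sum>k\<in>I. \<Sum>l\<in>signs. \<Sum>s<M.
      of_real (c k * W k) * E s (dot (reflect l k) v - dot (e k0) v))"
    by (subst sum.swap, intro sum.cong refl sum.swap)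
  also have "\<dots> = (\<Sum>k\<in>I. \<Sum>l\<in>signs. of_real (c k * W k) * (if reflect l k = e k0 then of_nat M else 0))"
    by (intro sum.cong refl) (simp only: sum_distrib_left[symmetric] sum_E)
  also have "\<dots> = (\<Sum>k\<in>I. if k = k0 then of_real (c k0 * W k0) * (of_nat n * of_nat M) else 0)"
  proof (intro sum.cong refl)
    fix k assume "k \<in> I"
    show "(\<Sum>l\<in>signs. of_real (c k * W k) * (if reflect l k = e k0 then of_nat M else 0)) =
      (if k = k0 then of_real (c k0 * W k0) * (of_nat n * of_nat M :: complex) else 0)"
    proof (cases "k = k0")
      case True
      then show ?thesis
        using fin by (simp add: sum_distrib_left[symmetric] sum.If_cases n_def Int_def)
    next
      case False
      then have "reflect l k \<noteq> e k0" if "l \<in> signs" for l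
        using reflect_eq_1D[OF that] unfolding e_def by metis
      then show ?thesis
        using False by simp
    qed
  qed
  also have "\<dots> = of_real (c k0 * W k0) * (of_nat n * of_nat M)"
    using I by simp
  finally have "of_real (c k0 * W k0) * (of_nat n * of_nat M) = (0 :: complex)" by simp
  moreover have "n > 0"
    unfolding n_def card_gt_0_iff using fin by (auto simp: e_def intro!: exI[of _ "\<lambda>_. 1"])
  moreover have "W k0 \<noteq> 0"
    by (simp add: W_def cheb_weight_def)
  ultimately show ?thesis
    using M by simp
qed

subsection \<open>Rank\<close>

lemma (in vec_space) rank_eq_dim_col:
  assumes A: "A \<in> carrier_mat n nc"
    and inj: "\<And>v. v \<in> carrier_vec nc \<Longrightarrow> A *\<^sub>v v = 0\<^sub>v n \<Longrightarrow> v = 0\<^sub>v nc"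
  shows "rank A = nc"
proof -
  \<comment> \<open>Linear independence refers to the set of columns and would miss a repetition.
    Two equal columns would put a difference of unit vectors into the kernel.\<close>
  have "distinct (cols A)"
  proof (rule ccontr)
    assume "\<not> distinct (cols A)"
    then obtain i j where ij: "i < nc" "j < nc" "i \<noteq> j" "cols A ! i = cols A ! j"
      using A by (auto simp: distinct_conv_nth)
    then have col: "col A i = col A j"
      using A by simp
    define v :: "'a Matrix.vec" where "v = unit_vec nc i - unit_vec nc j"
    have "A *\<^sub>v v = 0\<^sub>v n"
    proof (rule eq_vecI)
      fix r assume "r < dim_vec (0\<^sub>v n :: 'a Matrix.vec)"
      then have r: "r < n" by simp
      have "vec_index (A *\<^sub>v v) r = A $$ (r, i) - A $$ (r, j)"
        using A r ij by (simp add: v_def scalar_prod_minus_distrib[of _ nc])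
      also have "\<dots> = vec_index (col A i) r - vec_index (col A j) r"
        using A r ij(1,2) by simp
      finally show "vec_index (A *\<^sub>v v) r = vec_index (0\<^sub>v n) r"
        using col r by simp
    qed (use A in simp)
    then have "v = 0\<^sub>v nc"
      by (intro inj) (simp_all add: v_def)
    then have "vec_index v i = 0"
      using ij by simp
    then show False
      using ij by (simp add: v_def)
  qed
  moreover have "lin_indpt (set (cols A))"
    using lin_depE[OF A _ \<open>distinct (cols A)\<close>] inj by blast
  ultimately show ?thesis
    using lin_indpt_full_rank[OF A] by blast
qed

lemma cheb_full_column_rankI:
  fixes X :: "(real ^ 'd) set" and I :: "(nat ^ 'd) set"
  assumes "finite X" "finite I"
    and indep: "\<And>c k. k \<in> I \<Longrightarrow> (\<And>x. x \<in> X \<Longrightarrow> (\<Sum>k\<in>I. c k * mcheb k x) = 0) \<Longrightarrow> c k = 0"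
  shows "cheb_full_column_rank X I"
  unfolding cheb_full_column_rank_def
proof (intro conjI assms allI impI)
  fix xs ks assume *: "distinct xs \<and> set xs = X \<and> distinct ks \<and> set ks = I"
  define A where "A = cheb_matrix xs ks"
  have A: "A \<in> carrier_mat (length xs) (length ks)"
    by (simp add: A_def cheb_matrix_def)
  have bij: "bij_betw ((!) ks) {..<length ks} I"
    using * bij_betw_nth[of ks "{..<length ks}" I] by simp
  have "vec_space.rank (length xs) A = length ks"
  proof (rule vec_space.rank_eq_dim_col[OF A])
    fix v :: "real Matrix.vec"
    assume v: "v \<in> carrier_vec (length ks)" and Av: "A *\<^sub>v v = 0\<^sub>v (length xs)"
    \<comment> \<open>The entries of \<open>v\<close> become coefficients indexed by
      \<open>I\<close>, which makes \<open>indep\<close> applicable.\<close>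
    define c where "c k = vec_index v (the_inv_into {..<length ks} ((!) ks) k)" for k
    have c: "c (ks ! j) = vec_index v j" if "j < length ks" for j
      using bij that by (simp add: c_def bij_betw_def the_inv_into_f_f)
    have sum0: "(\<Sum>k\<in>I. c k * mcheb k x) = 0" if x: "x \<in> X" for x
    proof -
      obtain i where i: "i < length xs" "x = xs ! i"
        using x * by (auto simp: in_set_conv_nth)
      have "(\<Sum>k\<in>I. c k * mcheb k x) = (\<Sum>j<length ks. c (ks ! j) * mcheb (ks ! j) x)"
        by (rule sum.reindex_bij_betw[OF bij, symmetric])
      also have "\<dots> = vec_index (A *\<^sub>v v) i"
        using i v by (simp add: A_def cheb_matrix_def scalar_prod_def c atLeast0LessThan mult.commute)
      finally show ?thesis
        using Av i by simp
    qed
    show "v = 0\<^sub>v (length ks)"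
    proof (rule eq_vecI)
      fix j assume "j < dim_vec (0\<^sub>v (length ks) :: real Matrix.vec)"
      then have j: "j < length ks" by simp
      then have "ks ! j \<in> I"
        using * nth_mem by blast
      then have "c (ks ! j) = 0"
        by (rule indep) (rule sum0)
      then show "vec_index v j = vec_index (0\<^sub>v (length ks)) j"
        using c[OF j] j by simp
    qed (use v in simp)
  qed
  then show "full_column_rank (cheb_matrix xs ks)"
    using A by (simp add: full_column_rank_def A_def)
qed

subsection \<open>Counting aliasing generators\<close>

lemma finite_int_box: "finite {v :: int ^ 'd. \<forall>i. v $ i \<in> {a..b}}"
proof (rule finite_subset)
  show "{v :: int ^ 'd. \<forall>i. v $ i \<in> {a..b}} \<subseteq> vec_lambda ` (UNIV \<rightarrow>\<^sub>E {a..b})"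
    by (intro subsetI image_eqI[of _ vec_lambda "vec_nth _"]) auto
  show "finite (vec_lambda ` (UNIV \<rightarrow>\<^sub>E {a..b}) :: (int ^ 'd) set)"
    by (intro finite_imageI finite_PiE) auto
qed

lemma card_dot_dvd_le:
  fixes a :: "int ^ 'd"
  defines "Z m \<equiv> {v :: int ^ 'd. \<forall>i. v $ i \<in> {0..int m - 1}}"
  assumes M: "prime M" and j: "\<not> int M dvd a $ j"
  shows "card {v \<in> Z M. int M dvd dot a v} * M \<le> card (Z M)"
proof -
  \<comment> \<open>Shifting the \<open>j\<close>-th component of a solution by \<open>s\<close> makes the dot product \<open>s * a $ j\<close>, so
    solution and shift can be recovered from the result.\<close>
  define S where "S = {v \<in> Z M. int M dvd dot a v}"
  define f where "f = (\<lambda>(v, s). (\<chi> i. if i = j then (v $ i + s) mod int M else v $ i) :: int ^ 'd)"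
  have M0: "int M > 0"
    using M prime_gt_0_nat by simp
  have pM: "prime (int M)"
    using M by simp
  have fin: "finite (Z M)"
    unfolding Z_def by (rule finite_int_box)
  have "card S * M = card (S \<times> {0..<int M})"
    by (simp only: card_cartesian_product card_atLeastLessThan_int) simp
  also have "\<dots> \<le> card (Z M)"
  proof (rule card_inj_on_le[OF _ _ fin])
    show "f ` (S \<times> {0..<int M}) \<subseteq> Z M"
      using M0 by (auto simp: f_def Z_def S_def)
    show "inj_on f (S \<times> {0..<int M})"
    proof (rule inj_onI, clarify)
      fix v s v' s'
      assume v: "v \<in> S" and v': "v' \<in> S" and s: "s \<in> {0..<int M}" "s' \<in> {0..<int M}"
        and eq: "f (v, s) = f (v', s')"
      have f_i: "f (w, t) $ i = (if i = j then (w $ i + t) mod int M else w $ i)" for w t i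
        by (simp add: f_def)
      have other: "v $ i = v' $ i" if "i \<noteq> j" for i
        using f_i[of v s i] f_i[of v' s' i] eq that by simp
      have at_j: "(v $ j + s) mod int M = (v' $ j + s') mod int M"
        using f_i[of v s j] f_i[of v' s' j] eq by simp
      have "dot a v - dot a v' = (\<Sum>i\<in>UNIV. a $ i * (v $ i - v' $ i))"
        by (simp add: dot_def right_diff_distrib sum_subtractf)
      also have "\<dots> = (\<Sum>i\<in>UNIV. if i = j then a $ j * (v $ j - v' $ j) else 0)"
        by (intro sum.cong) (auto simp: other)
      also have "\<dots> = a $ j * (v $ j - v' $ j)"
        by simp
      \<comment> \<open>Both dot products are multiples of \<open>M\<close>; as \<open>M\<close> is
        prime, the factor \<open>a $ j\<close> can be cancelled.\<close>
      finally have "int M dvd a $ j * (v $ j - v' $ j)"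
        using v v' by (metis (no_types, lifting) S_def dvd_diff mem_Collect_eq)
      then have "int M dvd v $ j - v' $ j"
        using j pM by (simp add: prime_dvd_mult_iff)
      then have "v $ j mod int M = v' $ j mod int M"
        by (simp add: mod_eq_dvd_iff)
      moreover have "v $ j \<in> {0..<int M}" "v' $ j \<in> {0..<int M}"
        using v v' by (auto simp: S_def Z_def)
      ultimately have vj: "v $ j = v' $ j"
        by simp
      then have "v = v'"
        using other by (metis (no_types, lifting) Finite_Cartesian_Product.vec_eq_iff)
      have "int M dvd s - s'"
        using at_j vj by (simp add: mod_eq_dvd_iff)
      then have "s mod int M = s' mod int M"
        by (simp add: mod_eq_dvd_iff)
      then have "s = s'"
        using s by simp
      with \<open>v = v'\<close> show "v = v' \<and> s = s'" by simp
    qed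
  qed
  finally show ?thesis by (simp add: S_def)
qed

lemma mirrored_abs_le:
  fixes I :: "(nat ^ 'd) set"
  assumes "finite I" "h \<in> mirrored I"
  shows "\<bar>h $ i\<bar> \<le> int (Max (max_norm ` I))"
proof -
  obtain k and l :: "int ^ 'd" where kl: "k \<in> I" "\<And>i. l $ i \<in> {-1, 1}" "h = (\<chi> i. l $ i * int (k $ i))"
    using assms(2) unfolding mirrored_def by blast
  have "\<bar>h $ i\<bar> = int (k $ i)"
    using kl(2)[of i] kl(3) by auto
  also have "k $ i \<le> max_norm k"
    unfolding max_norm_def by (rule Max_ge) auto
  also have "max_norm k \<le> Max (max_norm ` I)"
    using assms(1) kl(1) by (intro Max_ge) auto
  finally show ?thesis by simp
qed

text \<open>Only the unreflected copy of \<open>k\<close> has to be isolated, because the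
  coefficient is read off there. Its competitors include the other reflections of
  \<open>k\<close>.\<close>

definition aliasing :: "(nat ^ 'd) set \<Rightarrow> nat \<Rightarrow> nat ^ 'd \<Rightarrow> (int ^ 'd) set" where
  "aliasing I M k = {v. \<exists>h\<in>mirrored I - {reflect (\<lambda>_. 1) k}. int M dvd dot (h - reflect (\<lambda>_. 1) k) v}"

text \<open>Two distinct mirrored frequencies differ in some entry, by at most twice the maximal
  norm and hence by less than \<open>M\<close>. So \<open>M\<close> does not divide that entry, the
  count for a single \<open>h\<close> applies, and the counts are added over all
  \<open>h\<close>.\<close>

lemma card_aliasing_le:
  fixes I :: "(nat ^ 'd) set"
  defines "Z m \<equiv> {v :: int ^ 'd. \<forall>i. v $ i \<in> {0..int m - 1}}"
  assumes I: "finite I" "finite (mirrored I)" "k \<in> I"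
    and M: "prime M" "M > 2 * Max (max_norm ` I)"
  shows "card (Z M \<inter> aliasing I M k) * M \<le> (card (mirrored I) - 1) * card (Z M)"
proof -
  define e where "e = reflect (\<lambda>_. 1) k"
  define B where "B h = {v \<in> Z M. int M dvd dot (h - e) v}" for h
  have e: "e \<in> mirrored I"
    unfolding e_def using I by (intro reflect_in_mirrored) auto
  have B: "card (B h) * M \<le> card (Z M)" if h: "h \<in> mirrored I - {e}" for h
  proof -
    obtain j where j: "h $ j \<noteq> e $ j"
      using h by (auto simp: Finite_Cartesian_Product.vec_eq_iff)
    have "\<bar>h $ j\<bar> \<le> int (Max (max_norm ` I))" "\<bar>e $ j\<bar> \<le> int (Max (max_norm ` I))"
      using mirrored_abs_le[OF I(1)] h e by auto
    then have "\<bar>h $ j - e $ j\<bar> < int M"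
      using M(2) by linarith
    then have "\<not> int M dvd (h - e) $ j"
      using j dvd_imp_le_int[of "h $ j - e $ j" "int M"] by auto
    then show ?thesis
      unfolding B_def Z_def by (rule card_dot_dvd_le[OF M(1)])
  qed
  have "Z M \<inter> aliasing I M k = (\<Union>h\<in>mirrored I - {e}. B h)"
    by (auto simp: aliasing_def B_def e_def)
  then have "card (Z M \<inter> aliasing I M k) \<le> (\<Sum>h\<in>mirrored I - {e}. card (B h))"
    using card_UN_le[of "mirrored I - {e}" B] I by simp
  then have "card (Z M \<inter> aliasing I M k) * M \<le> (\<Sum>h\<in>mirrored I - {e}. card (B h) * M)"
    by (metis mult_le_mono1 sum_distrib_right)
  also have "\<dots> \<le> (\<Sum>h\<in>mirrored I - {e}. card (Z M))"
    by (intro sum_mono B)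
  also have "\<dots> = (card (mirrored I) - 1) * card (Z M)"
    using e I by simp
  finally show ?thesis .
qed

section \<open>Full rank from several lattices, and its probability\<close>

lemma cheb_full_column_rank_if_not_aliasing:
  assumes "finite I" "M > 0"
    and "\<And>k. k \<in> I \<Longrightarrow> \<exists>l\<in>{1..L}. z l \<notin> aliasing I M k"
  shows "cheb_full_column_rank (cheb_nodes z L M) I"
proof (rule cheb_full_column_rankI[OF finite_cheb_nodes assms(1)])
  fix c :: "nat ^ 'a \<Rightarrow> real" and k
  assume k: "k \<in> I" and zero: "\<And>x. x \<in> cheb_nodes z L M \<Longrightarrow> (\<Sum>k\<in>I. c k * mcheb k x) = 0"
  \<comment> \<open>The lattice may depend on \<open>k\<close>: each coefficient is shown to vanish
    separately.\<close>
  obtain l where l: "l \<in> {1..L}" "z l \<notin> aliasing I M k"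
    using assms(3)[OF k] by blast
  show "c k = 0"
  proof (rule mcheb_coeff_eq_0[OF assms(1) k assms(2)])
    show "\<not> int M dvd dot (h - reflect (\<lambda>_. 1) k) (z l)"
      if "h \<in> mirrored I" "h \<noteq> reflect (\<lambda>_. 1) k" for h
      using l(2) that by (auto simp: aliasing_def)
    show "(\<Sum>k\<in>I. c k * mcheb k (node (z l) M s)) = 0" if "s < M" for s
      using l(1) that by (intro zero) (auto simp: cheb_nodes_def cos2pi_image_rank1_lattice)
  qed
qed

text \<open>Since \<open>ln 2 \<ge> 1 / 2\<close>, the factor 2 in the bound on \<open>L\<close>
  yields \<open>L * ln 2 \<ge> (r + 1) * ln n\<close>. One of the \<open>r + 1\<close> powers of
  \<open>n\<close> absorbs the union bound.\<close>

lemma card_mult_half_power_le: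
  fixes n r :: real and L :: nat
  assumes "n \<ge> 1" "r \<ge> 0" "2 * (r + 1) * ln n \<le> L"
  shows "n * (1 / 2) ^ L \<le> n powr (- r)"
proof -
  have "(1 / 2 :: real) ^ L = exp (- (L * ln 2))"
    by (simp add: exp_minus exp_of_nat_mult power_one_over inverse_eq_divide)
  also have "L * (1 / 2) \<le> L * ln (2::real)"
    using ln2_ge_two_thirds by (intro mult_left_mono) auto
  then have "- (L * ln (2::real)) \<le> - ((r + 1) * ln n)"
    using assms(3) by (simp add: algebra_simps)
  finally have "(1 / 2 :: real) ^ L \<le> exp (- ((r + 1) * ln n))"
    by simp
  then have "n * (1 / 2) ^ L \<le> n * exp (- ((r + 1) * ln n))"
    using assms by (intro mult_left_mono) auto
  also have "\<dots> = exp (ln n) * exp (- ((r + 1) * ln n))"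
    using assms by simp
  also have "\<dots> = n powr (- r)"
    unfolding exp_add[symmetric] using assms by (simp add: powr_def algebra_simps)
  finally show ?thesis .
qed

theorem mainTheorem2:
  fixes I :: "(nat ^ 'd) set"
    and r :: real
    and N M L :: nat
    and Z :: "(int ^ 'd) set"
    and P :: "'w measure"
    and z :: "nat \<Rightarrow> 'w \<Rightarrow> int ^ 'd"
  assumes "finite I" and "card I \<ge> 1" and "card (mirrored I) > 1"
    and "r \<ge> 0"
    and "N = Max (max_norm ` I)"
    and "M = nextprime (max (2 * (card (mirrored I) - 1)) (2 * N))"
    and "L = nat \<lceil>2 * (r + 1) * ln (real (card I))\<rceil>"
    and "Z = {v. \<forall>i. v $ i \<in> {0..int M - 1}}"
    and "prob_space P"
    and "prob_space.indep_vars P (\<lambda>_. uniform_count_measure Z) z {1..L}"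
    and "\<forall>l\<in>{1..L}. distr P (uniform_count_measure Z) (z l) = uniform_count_measure Z"
  shows "(\<forall>\<omega>\<in>space P.
            int (card (cheb_nodes (\<lambda>l. z l \<omega>) L M))
              \<le> 2 * \<lceil>2 * (r + 1) * ln (real (card I))\<rceil> * int (max (card (mirrored I) - 1) N)) \<and>
         measure P {\<omega> \<in> space P. cheb_full_column_rank (cheb_nodes (\<lambda>l. z l \<omega>) L M) I}
           \<ge> 1 - real (card I) powr (- r)"
proof -
  interpret prob_space P by fact
  define m where "m = max (card (mirrored I) - 1) N"
  have m: "m \<ge> 1" "M = nextprime (2 * m)"
    using assms(3,6) by (auto simp: m_def nat_mult_max_right)
  have M: "prime M" "2 * m < M"
    using nextprime_prime nextprime_greater by (auto simp: m(2))
  have M0: "M > 0"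
    using M(1) by (rule prime_gt_0_nat)
  have M_le: "M div 2 + 1 \<le> 2 * m"
  proof -
    obtain p where p: "prime p" "2 * m < p" "p \<le> 2 * (2 * m)"
      using Bertrand_postulate[of "2 * m"] m(1) by auto
    then have "M \<le> 2 * (2 * m)"
      using nextprime_le[OF p(1,2)] m(2) by simp
    \<comment> \<open>Oddness improves \<open>M \<le> 4 * m\<close> to
      \<open>M \<le> 4 * m - 1\<close>, which pays for the extra node in
      \<open>M div 2 + 1\<close>.\<close>
    moreover have "odd M"
      using prime_odd_nat[OF M(1)] M(2) m(1) by simp
    ultimately show ?thesis
      by (auto elim!: oddE)
  qed
  have fin_mir: "finite (mirrored I)"
    using assms(3) by (intro card_ge_0_finite) simp
  have finZ: "finite Z"
    unfolding assms(8) by (rule finite_int_box)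
  have L_ge: "2 * (r + 1) * ln (card I) \<le> L"
    unfolding assms(7) by linarith
  \<comment> \<open>Hence \<open>nat\<close> in the definition of \<open>L\<close> does not
    truncate.\<close>
  have "2 * (r + 1) * ln (card I) \<ge> 0"
    using assms(2,4) by simp
  then have ceil_nonneg: "\<lceil>2 * (r + 1) * ln (card I)\<rceil> \<ge> 0"
    by linarith
  have card_le: "int (card (cheb_nodes y L M)) \<le> 2 * \<lceil>2 * (r + 1) * ln (card I)\<rceil> * int m" for y :: "nat \<Rightarrow> int ^ 'd"
  proof -
    have "card (cheb_nodes y L M) \<le> L * (M div 2 + 1)"
      by (rule card_cheb_nodes_le)
    also have "\<dots> \<le> L * (2 * m)"
      using M_le by (rule mult_le_mono2)
    finally have "int (card (cheb_nodes y L M)) \<le> int (L * (2 * m))"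
      by (rule of_nat_mono)
    then show ?thesis
      using ceil_nonneg by (simp add: assms(7))
  qed
  define good where "good = {\<omega> \<in> space P. cheb_full_column_rank (cheb_nodes (\<lambda>l. z l \<omega>) L M) I}"
  have "prob good \<ge> 1 - real (card I) powr (- r)"
  \<comment> \<open>Here the logarithm is 0, so there are no lattices at all, but the claimed lower
    bound is 0 as well. Otherwise \<open>L > 0\<close>, so the intersections over
    \<open>{1..L}\<close> below are nonempty.\<close>
  proof (cases "card I = 1")
    case True
    then show ?thesis by simp
  next
    case False
    then have "2 * (r + 1) * ln (card I) > 0"
      using assms(2,4) by simp
    then have "L > 0"
      using L_ge by linarith
    have rv: "z l \<in> measurable P (uniform_count_measure Z)" if "l \<in> {1..L}" for l
      using assms(10) that by (auto simp: indep_vars_def)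
    have sets: "z l -` A \<inter> space P \<in> events" if "l \<in> {1..L}" "A \<subseteq> Z" for l A
      using measurable_sets[OF rv[OF that(1)], of A] that(2) by (simp add: sets_uniform_count_measure)
    have in_Z: "z l \<omega> \<in> Z" if "l \<in> {1..L}" "\<omega> \<in> space P" for l \<omega>
      using measurable_space[OF rv[OF that(1)] that(2)] by (simp add: space_uniform_count_measure)
    have prob_eq: "prob (z l -` A \<inter> space P) = card A / card Z" if "l \<in> {1..L}" "A \<subseteq> Z" for l A
    proof -
      have "prob (z l -` A \<inter> space P) = measure (distr P (uniform_count_measure Z) (z l)) A"
        using that by (intro measure_distr[symmetric] rv) (auto simp: sets_uniform_count_measure)
      also have "\<dots> = card A / card Z"
        using assms(11) that finZ by (simp add: measure_uniform_count_measure)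
      finally show ?thesis .
    qed
    have good_event: "good \<in> events"
    proof -
      \<comment> \<open>The event depends only on the tuple of generators, which takes finitely many
        values; it is a finite union of measurable preimages.\<close>
      define F where "F = {y \<in> {1..L} \<rightarrow>\<^sub>E Z. cheb_full_column_rank (cheb_nodes y L M) I}"
      have nodes_cong: "cheb_nodes y L M = cheb_nodes y' L M" if "\<And>l. l \<in> {1..L} \<Longrightarrow> y l = y' l"
        for y y' :: "nat \<Rightarrow> int ^ 'd"
        using that by (simp add: cheb_nodes_def)
      have "good = (\<Union>y\<in>F. \<Inter>l\<in>{1..L}. z l -` {y l} \<inter> space P)"
      proof (intro equalityI subsetI)
        fix \<omega> assume \<omega>: "\<omega> \<in> good"
        define y where "y = restrict (\<lambda>l. z l \<omega>) {1..L}"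
        have "cheb_nodes y L M = cheb_nodes (\<lambda>l. z l \<omega>) L M"
          by (rule nodes_cong) (simp add: y_def)
        then have "y \<in> F"
          using \<omega> in_Z by (auto simp: F_def good_def y_def)
        moreover have "\<omega> \<in> (\<Inter>l\<in>{1..L}. z l -` {y l} \<inter> space P)"
          using \<omega> by (auto simp: good_def y_def)
        ultimately show "\<omega> \<in> (\<Union>y\<in>F. \<Inter>l\<in>{1..L}. z l -` {y l} \<inter> space P)"
          by blast
      next
        fix \<omega> assume "\<omega> \<in> (\<Union>y\<in>F. \<Inter>l\<in>{1..L}. z l -` {y l} \<inter> space P)"
        then obtain y where y: "y \<in> F" "\<And>l. l \<in> {1..L} \<Longrightarrow> \<omega> \<in> z l -` {y l} \<inter> space P"
          by blast
        then have "cheb_nodes y L M = cheb_nodes (\<lambda>l. z l \<omega>) L M"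
          by (intro nodes_cong) simp
        moreover have "\<omega> \<in> space P"
          using y(2)[of 1] \<open>L > 0\<close> by simp
        ultimately show "\<omega> \<in> good"
          using y(1) by (simp add: F_def good_def)
      qed
      also have "\<dots> \<in> events"
      proof (intro sets.finite_UN sets.finite_INT sets)
        show "finite F"
          unfolding F_def using finZ by (intro finite_subset[OF _ finite_PiE[of "{1..L}" "\<lambda>_. Z"]]) auto
      qed (use \<open>L > 0\<close> in \<open>auto simp: F_def\<close>)
      finally show ?thesis .
    qed
    \<comment> \<open>The event that \<open>k\<close> is aliased on every lattice; by independence
      its probability is an \<open>L\<close>-th power.\<close>
    define bad where "bad k = (\<Inter>l\<in>{1..L}. z l -` (Z \<inter> aliasing I M k) \<inter> space P)" for k
    have bad_event: "bad k \<in> events" for k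
      unfolding bad_def using \<open>L > 0\<close> by (intro sets.finite_INT sets) auto
    have prob_bad: "prob (bad k) \<le> (1 / 2) ^ L" if k: "k \<in> I" for k
    proof -
      define q where "q = real (card (Z \<inter> aliasing I M k)) / card Z"
      have "N \<le> m" "card (mirrored I) - 1 \<le> m"
        by (auto simp: m_def)
      have "card (Z \<inter> aliasing I M k) * M \<le> (card (mirrored I) - 1) * card Z"
        unfolding assms(8) using assms(1) fin_mir k M \<open>N \<le> m\<close>
        by (intro card_aliasing_le) (auto simp: assms(5))
      then have "(2 * card (Z \<inter> aliasing I M k)) * M \<le> (2 * (card (mirrored I) - 1)) * card Z"
        by simp
      \<comment> \<open>Here the choice of \<open>M\<close> above
        \<open>2 * (card (mirrored I) - 1)\<close> brings the failure rate of one lattice down to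
        one half.\<close>
      also have "\<dots> \<le> M * card Z"
        using M(2) \<open>card (mirrored I) - 1 \<le> m\<close> by (intro mult_le_mono1) linarith
      finally have "2 * card (Z \<inter> aliasing I M k) \<le> card Z"
        using M0 by simp
      then have "q \<le> 1 / 2"
        unfolding q_def by (cases "card Z = 0") (auto simp: field_simps)
      have "prob (bad k) = (\<Prod>l\<in>{1..L}. prob (z l -` (Z \<inter> aliasing I M k) \<inter> space P))"
        unfolding bad_def using \<open>L > 0\<close>
        by (intro indep_varsD_finite[OF assms(10)]) (auto simp: sets_uniform_count_measure)
      also have "\<dots> = q ^ L"
        by (subst prod.cong[OF refl prob_eq]) (auto simp: q_def)
      also have "\<dots> \<le> (1 / 2) ^ L"
        using \<open>q \<le> 1 / 2\<close> by (intro power_mono) (auto simp: q_def)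
      finally show ?thesis .
    qed
    have "prob (\<Union>k\<in>I. bad k) \<le> (\<Sum>k\<in>I. prob (bad k))"
      using bad_event assms(1) by (intro finite_measure_subadditive_finite) auto
    also have "\<dots> \<le> (\<Sum>k\<in>I. (1 / 2) ^ L)"
      by (intro sum_mono prob_bad)
    also have "\<dots> = card I * (1 / 2) ^ L"
      by simp
    also have "\<dots> \<le> real (card I) powr (- r)"
      using assms(2,4) L_ge by (intro card_mult_half_power_le) auto
    finally have "prob (\<Union>k\<in>I. bad k) \<le> real (card I) powr (- r)" .
    moreover have "prob (space P - (\<Union>k\<in>I. bad k)) = 1 - prob (\<Union>k\<in>I. bad k)"
      using bad_event assms(1) by (intro prob_compl sets.finite_UN) auto
    moreover have "space P - (\<Union>k\<in>I. bad k) \<subseteq> good"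
    proof
      fix \<omega> assume \<omega>: "\<omega> \<in> space P - (\<Union>k\<in>I. bad k)"
      have "cheb_full_column_rank (cheb_nodes (\<lambda>l. z l \<omega>) L M) I"
      proof (rule cheb_full_column_rank_if_not_aliasing[OF assms(1) M0])
        fix k assume "k \<in> I"
        then have "\<omega> \<notin> bad k" using \<omega> by blast
        then obtain l where l: "l \<in> {1..L}" "\<omega> \<notin> z l -` (Z \<inter> aliasing I M k) \<inter> space P"
          unfolding bad_def by blast
        then have "z l \<omega> \<notin> aliasing I M k"
          using in_Z[OF l(1)] \<omega> by simp
        with l(1) show "\<exists>l\<in>{1..L}. z l \<omega> \<notin> aliasing I M k"
          by blast
      qed
      with \<omega> show "\<omega> \<in> good" by (simp add: good_def)
    qed
    then have "prob (space P - (\<Union>k\<in>I. bad k)) \<le> prob good"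
      by (rule finite_measure_mono) (rule good_event)
    ultimately show ?thesis by linarith
  qed
  then show ?thesis
    using card_le by (simp add: good_def m_def)
qed

end
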